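(* Let $G$ be an unweighted graph such that (the shortest-path metric of) $G$ admits an embedding into a weighted path or a weighted cycle with distortion at most $\rho$. Then on $G$, the $\mathcal{E}_0$ planning algorithm described in the context incurs cost at most $\mathrm{OPT}+O(\rho\,\mathcal{E}_0)$.
   Context: Planning setting: $G=(V,E)$ is a finite connected undirected graph with shortest-path distance $d_G$; the searcher starts at $r\in V$, knows all of $G$ and predictions $f:V\to\mathbb{R}$ in advance, and must visit an unknown goal $g$ (recognized upon visiting); cost is the total distance travelled until $g$ is visited and $\mathrm{OPT}=d_G(r,g)$. Let $\mathcal{E}_0=|\{v\in V: f(v)\ne d_G(v,g)\}|$ and $\phi_0(v)=|\{u\in V: f(u)\ne d_G(u,v)\}|$. The $\mathcal{E}_0$ planning algorithm: set $U=\{r\}$, $\lambda=0$; while $g$ has not been visited, set $U\leftarrow U\cup\{v: \phi_0(v)\le 2^\lambda\}$, compute a minimum-length Steiner tree spanning $U$, walk to it and traverse it by an Euler tour, and set $\lambda\leftarrow\lambda+1$. Distortion: a map $\tau:X\to Y$ between finite metric spaces has distortion at most $\rho$ if there is $c>0$ with $c\,d_X(x_1,x_2)\le d_Y(\tau(x_1),\tau(x_2))\le c\rho\, d_X(x_1,x_2)$ for all $x_1,x_2\in X$. The $O(\cdot)$ hides an absolute constant.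
   Formalization: Each phase's Steiner tree spans U without the already visited start r (always omitted), not U: with r as terminal the bound fails (path of length D from r to x, leaves a,b,c at x, goal b, f=d(.,a): cost at least 3(D+1), OPT=D+1, error 2). Vertices are naturals; rho is nonnegative. *)

theory Defs
  imports Complex_Main
begin

section \<open>Finite undirected graphs and their shortest-path metrics\<close>

type_synonym 'a edges = "'a set set"

definition graph :: "'a set \<Rightarrow> 'a edges \<Rightarrow> bool" where
  "graph V E \<longleftrightarrow> finite V \<and> E \<subseteq> {{u, v} |u v. u \<in> V \<and> v \<in> V \<and> u \<noteq> v}"

text \<open>A walk is the nonempty list of its vertices.\<close>

definition walk :: "'a set \<Rightarrow> 'a edges \<Rightarrow> 'a list \<Rightarrow> bool" where
  "walk V E p \<longleftrightarrow> p \<noteq> [] \<and> set p \<subseteq> V \<and> successively (\<lambda>u v. {u, v} \<in> E) p"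

definition walk_arcs :: "'a list \<Rightarrow> ('a \<times> 'a) list" where
  "walk_arcs p = zip p (tl p)"

definition walk_weight :: "('a set \<Rightarrow> real) \<Rightarrow> 'a list \<Rightarrow> real" where
  "walk_weight w p = (\<Sum>(u, v)\<leftarrow>walk_arcs p. w {u, v})"

definition connected_graph :: "'a set \<Rightarrow> 'a edges \<Rightarrow> bool" where
  "connected_graph V E \<longleftrightarrow> graph V E \<and> V \<noteq> {} \<and>
     (\<forall>u\<in>V. \<forall>v\<in>V. \<exists>p. walk V E p \<and> hd p = u \<and> last p = v)"

definition wdist :: "'a set \<Rightarrow> 'a edges \<Rightarrow> ('a set \<Rightarrow> real) \<Rightarrow> 'a \<Rightarrow> 'a \<Rightarrow> real" where
  "wdist V E w u v = Inf {walk_weight w p |p. walk V E p \<and> hd p = u \<and> last p = v}"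

abbreviation gdist :: "'a set \<Rightarrow> 'a edges \<Rightarrow> 'a \<Rightarrow> 'a \<Rightarrow> real" where
  "gdist V E \<equiv> wdist V E (\<lambda>_. 1)"


section \<open>Embeddings into weighted paths and weighted cycles\<close>

definition distortion_at_most ::
  "'a set \<Rightarrow> ('a \<Rightarrow> 'a \<Rightarrow> real) \<Rightarrow> 'b set \<Rightarrow> ('b \<Rightarrow> 'b \<Rightarrow> real) \<Rightarrow> ('a \<Rightarrow> 'b) \<Rightarrow> real \<Rightarrow> bool" where
  "distortion_at_most X dX Y dY \<tau> \<rho> \<longleftrightarrow> \<tau> ` X \<subseteq> Y \<and>
     (\<exists>c>0. \<forall>x1\<in>X. \<forall>x2\<in>X.
        c * dX x1 x2 \<le> dY (\<tau> x1) (\<tau> x2) \<and> dY (\<tau> x1) (\<tau> x2) \<le> c * \<rho> * dX x1 x2)"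

definition path_edges :: "nat \<Rightarrow> nat edges" where
  "path_edges m = {{i, Suc i} |i. Suc i < m}"

definition cycle_edges :: "nat \<Rightarrow> nat edges" where
  "cycle_edges m = insert {m - 1, 0} (path_edges m)"

definition embeds_in_weighted_path :: "'a set \<Rightarrow> 'a edges \<Rightarrow> real \<Rightarrow> bool" where
  "embeds_in_weighted_path V E \<rho> \<longleftrightarrow>
     (\<exists>m w \<tau>. 1 \<le> m \<and> (\<forall>e\<in>path_edges m. 0 < w e) \<and>
        distortion_at_most V (gdist V E) {..<m} (wdist {..<m} (path_edges m) w) \<tau> \<rho>)"

definition embeds_in_weighted_cycle :: "'a set \<Rightarrow> 'a edges \<Rightarrow> real \<Rightarrow> bool" where
  "embeds_in_weighted_cycle V E \<rho> \<longleftrightarrow>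
     (\<exists>m w \<tau>. 3 \<le> m \<and> (\<forall>e\<in>cycle_edges m. 0 < w e) \<and>
        distortion_at_most V (gdist V E) {..<m} (wdist {..<m} (cycle_edges m) w) \<tau> \<rho>)"


section \<open>Trees, Steiner trees, Euler tours\<close>

definition is_cycle :: "'a set \<Rightarrow> 'a edges \<Rightarrow> 'a list \<Rightarrow> bool" where
  "is_cycle V E p \<longleftrightarrow> walk V E p \<and> hd p = last p \<and> distinct (tl p) \<and> 4 \<le> length p"

definition tree :: "'a set \<Rightarrow> 'a edges \<Rightarrow> bool" where
  "tree T F \<longleftrightarrow> connected_graph T F \<and> (\<nexists>p. is_cycle T F p)"

definition steiner_tree :: "'a set \<Rightarrow> 'a edges \<Rightarrow> 'a set \<Rightarrow> 'a set \<Rightarrow> 'a edges \<Rightarrow> bool" where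
  "steiner_tree V E W T F \<longleftrightarrow> T \<subseteq> V \<and> F \<subseteq> E \<and> tree T F \<and> W \<subseteq> T"

definition min_steiner_tree :: "'a set \<Rightarrow> 'a edges \<Rightarrow> 'a set \<Rightarrow> 'a set \<Rightarrow> 'a edges \<Rightarrow> bool" where
  "min_steiner_tree V E W T F \<longleftrightarrow> steiner_tree V E W T F \<and>
     (\<forall>T' F'. steiner_tree V E W T' F' \<longrightarrow> card F \<le> card F')"

text \<open>An Euler tour of a tree is a closed walk that uses every edge exactly once in each of its two
  directions.\<close>

definition euler_tour :: "'a set \<Rightarrow> 'a edges \<Rightarrow> 'a list \<Rightarrow> bool" where
  "euler_tour T F t \<longleftrightarrow> walk T F t \<and> hd t = last t \<and>
     distinct (walk_arcs t) \<and> set (walk_arcs t) = {(u, v). {u, v} \<in> F}"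


section \<open>The planning algorithm\<close>

definition phi0 :: "'a set \<Rightarrow> 'a edges \<Rightarrow> ('a \<Rightarrow> real) \<Rightarrow> 'a \<Rightarrow> nat" where
  "phi0 V E f v = card {u \<in> V. f u \<noteq> gdist V E u v}"

definition err0 :: "'a set \<Rightarrow> 'a edges \<Rightarrow> ('a \<Rightarrow> real) \<Rightarrow> 'a \<Rightarrow> nat" where
  "err0 V E f g = card {v \<in> V. f v \<noteq> gdist V E v g}"

text \<open>\<open>candidates V E f r n\<close> is the set \<open>U\<close> after \<open>n\<close> updates; update number \<open>n\<close>, counting from 0,
  is made with \<open>\<lambda> = n\<close>.\<close>

primrec candidates :: "'a set \<Rightarrow> 'a edges \<Rightarrow> ('a \<Rightarrow> real) \<Rightarrow> 'a \<Rightarrow> nat \<Rightarrow> 'a set" where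
  "candidates V E f r 0 = {r}"
| "candidates V E f r (Suc n) = candidates V E f r n \<union> {v \<in> V. phi0 V E f v \<le> 2 ^ n}"

definition shortest_walk_to :: "'a set \<Rightarrow> 'a edges \<Rightarrow> 'a \<Rightarrow> 'a set \<Rightarrow> 'a list \<Rightarrow> bool" where
  "shortest_walk_to V E x T s \<longleftrightarrow> walk V E s \<and> hd s = x \<and> last s \<in> T \<and>
     (\<forall>s'. walk V E s' \<and> hd s' = x \<and> last s' \<in> T \<longrightarrow> length s \<le> length s')"

text \<open>One phase, started at the current position \<open>x\<close>: choose a minimum Steiner tree for the terminals
  \<open>W\<close>, walk to it, and traverse it completely by an Euler tour. All ties may be broken arbitrarily.
  Without terminals there is no tree, and the searcher does not move.\<close>

definition phase_walk :: "'a set \<Rightarrow> 'a edges \<Rightarrow> 'a set \<Rightarrow> 'a \<Rightarrow> 'a list \<Rightarrow> bool" where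
  "phase_walk V E W x q \<longleftrightarrow>
     (if W = {} then q = [x]
      else \<exists>T F s t. min_steiner_tree V E W T F \<and> shortest_walk_to V E x T s \<and>
             euler_tour T F t \<and> hd t = last s \<and> q = s @ tl t)"

text \<open>\<open>P n\<close> is the whole walk made by the searcher in the first \<open>n\<close> phases; it stays constant once the
  goal has been visited.

  The start \<open>r\<close> belongs to \<open>U\<close> from the beginning and is already visited; it is not a terminal
  of the Steiner trees, which are trees that the searcher walks to from \<open>r\<close>. With \<open>r\<close> as a terminal,
  the searcher would travel from the candidates back to \<open>r\<close> in every phase, and the cost could not be
  bounded by \<open>OPT + O(\<rho> \<E>\<^sub>0)\<close>: take a path from \<open>r\<close> of length \<open>D\<close> whose other end \<open>x\<close> has three further
  neighbours \<open>a\<close>, \<open>b\<close>, \<open>c\<close>, all of them leaves, let \<open>b\<close> be the goal and \<open>f = d(\<cdot>, a)\<close>. Then the error is 2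
  and the distortion is bounded, but for large \<open>D\<close> phase 0 is the round trip from \<open>r\<close> to \<open>a\<close>, so that
  the cost is at least \<open>3 (D + 1)\<close>, whereas \<open>OPT = D + 1\<close>.\<close>

definition e0_planning_execution ::
  "'a set \<Rightarrow> 'a edges \<Rightarrow> ('a \<Rightarrow> real) \<Rightarrow> 'a \<Rightarrow> 'a \<Rightarrow> (nat \<Rightarrow> 'a list) \<Rightarrow> bool" where
  "e0_planning_execution V E f r g P \<longleftrightarrow> P 0 = [r] \<and>
     (\<forall>n. if g \<in> set (P n) then P (Suc n) = P n
          else \<exists>q. phase_walk V E (candidates V E f r (Suc n) - {r}) (last (P n)) q \<and>
                 P (Suc n) = P n @ tl q)"

definition cost_until :: "'a \<Rightarrow> 'a list \<Rightarrow> nat" where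
  "cost_until g p = length (takeWhile (\<lambda>v. v \<noteq> g) p)"

end

theory Submission
  imports Defs
begin

text \<open>Two vertices are at distance at most the sum of their \<open>\<phi>\<^sub>0\<close>-values, because almost every vertex of a
  shortest walk between them tells their distance functions apart. So the candidates of phase \<open>\<lambda>\<close>
  have diameter at most \<open>2 * 2 ^ \<lambda>\<close>, and on a path or a circle a set of diameter \<open>D\<close> is visited by two
  sweeps of length \<open>D\<close>, to which the distortion adds a factor \<open>\<rho>\<close>; hence the Steiner tree of that phase has at most \<open>4 \<rho> * 2 ^ \<lambda>\<close> edges. These
  costs form a geometric series up to the first \<open>\<lambda>\<close> with \<open>\<E>\<^sub>0 \<le> 2 ^ \<lambda>\<close>, by which time the goal is a
  terminal. The first walk away from \<open>r\<close> leads to a vertex near the goal, which accounts for the term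
  \<open>OPT\<close>. If \<open>\<E>\<^sub>0 = 0\<close> there is no additive slack at all, but then the goal is the only candidate of
  phase 0.\<close>

section \<open>Walks and distances\<close>

lemma walk_singleton [simp]: "walk V E [x] \<longleftrightarrow> x \<in> V"
  by (simp add: walk_def)

lemma walk_mono: "walk T F p \<Longrightarrow> T \<subseteq> V \<Longrightarrow> F \<subseteq> E \<Longrightarrow> walk V E p"
  unfolding walk_def by (auto intro: successively_mono)

lemma walk_Cons_Cons: "walk V E (x # y # p) \<longleftrightarrow> x \<in> V \<and> {x, y} \<in> E \<and> walk V E (y # p)"
  by (auto simp: walk_def)

lemma walk_append:
  assumes "walk V E p" "walk V E q" "last p = hd q"
  shows "walk V E (p @ tl q)" "hd (p @ tl q) = hd p" "last (p @ tl q) = last q"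
proof -
  obtain a q' where q: "q = a # q'" using assms(2) by (cases q) (auto simp: walk_def)
  have "p \<noteq> []" using assms(1) by (simp add: walk_def)
  then show "walk V E (p @ tl q)" "hd (p @ tl q) = hd p" "last (p @ tl q) = last q"
    using assms q by (cases q'; auto simp: walk_def successively_append_iff)+
qed

lemma walk_take:
  assumes "walk V E p" "i < length p"
  shows "walk V E (take (Suc i) p)" "hd (take (Suc i) p) = hd p" "last (take (Suc i) p) = p ! i"
proof -
  have "successively (\<lambda>u v. {u, v} \<in> E) (take (Suc i) p @ drop (Suc i) p)"
    using assms by (simp add: walk_def)
  then have "successively (\<lambda>u v. {u, v} \<in> E) (take (Suc i) p)"
    unfolding successively_append_iff by blast
  then show "walk V E (take (Suc i) p)"
    using assms set_take_subset[of "Suc i" p] by (auto simp: walk_def)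
  show "hd (take (Suc i) p) = hd p" using assms by (cases p) auto
  show "last (take (Suc i) p) = p ! i" using assms by (simp add: take_Suc_conv_app_nth)
qed

lemma walk_drop:
  assumes "walk V E p" "i < length p"
  shows "walk V E (drop i p)" "hd (drop i p) = p ! i" "last (drop i p) = last p"
proof -
  have "successively (\<lambda>u v. {u, v} \<in> E) (take i p @ drop i p)"
    using assms by (simp add: walk_def)
  then have "successively (\<lambda>u v. {u, v} \<in> E) (drop i p)"
    unfolding successively_append_iff by blast
  then show "walk V E (drop i p)"
    using assms set_drop_subset[of i p] by (auto simp: walk_def)
  show "hd (drop i p) = p ! i" using assms by (simp add: hd_drop_conv_nth)
  show "last (drop i p) = last p" using assms by simp
qed

lemma walk_rev: "walk V E p \<Longrightarrow> walk V E (rev p)"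
  by (simp add: walk_def insert_commute)

lemma walk_nth_edge:
  assumes "walk V E p" "Suc i < length p"
  shows "{p ! i, p ! Suc i} \<in> E"
  using assms by (simp add: walk_def successively_conv_nth)

section \<open>Weights of walks and weighted distances\<close>

lemma walk_weight_Cons_Cons:
  "walk_weight w (x # y # p) = w {x, y} + walk_weight w (y # p)"
  by (simp add: walk_weight_def walk_arcs_def)

lemma walk_weight_singleton [simp]: "walk_weight w [x] = 0"
  by (simp add: walk_weight_def walk_arcs_def)

lemma walk_weight_append:
  "p \<noteq> [] \<Longrightarrow> q \<noteq> [] \<Longrightarrow> last p = hd q \<Longrightarrow>
    walk_weight w (p @ tl q) = walk_weight w p + walk_weight w q"
proof (induction p rule: induct_list012)
  case (2 x)
  then show ?case by (cases q) (auto simp: walk_weight_def walk_arcs_def)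
qed (auto simp: walk_weight_Cons_Cons)

lemma length_walk_arcs: "length (walk_arcs p) = length p - 1"
  by (simp add: walk_arcs_def)

lemma walk_weight_one: "walk_weight (\<lambda>_. 1) p = real (length p - 1)"
proof -
  have "(\<lambda>(u, v). (1::real)) = (\<lambda>_ :: 'a \<times> 'a. 1)" by auto
  then show ?thesis by (simp add: walk_weight_def length_walk_arcs sum_list_triv)
qed

text \<open>The increments of \<open>k\<close> telescope along the walk, and each is at most the
  weight of its edge.\<close>

lemma walk_weight_potential:
  assumes "\<And>u v. u \<in> V \<Longrightarrow> v \<in> V \<Longrightarrow> {u, v} \<in> E \<Longrightarrow> k v - k u \<le> w {u, v}"
  shows "walk V E p \<Longrightarrow> k (last p) - k (hd p) \<le> walk_weight w p"
proof (induction p rule: induct_list012)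
  case (3 x y zs)
  then have "k y - k x \<le> w {x, y}" using assms by (auto simp: walk_def)
  with 3 show ?case by (auto simp: walk_Cons_Cons walk_weight_Cons_Cons)
qed (auto simp: walk_def)

lemma wdist_le:
  assumes "\<And>e. e \<in> E \<Longrightarrow> 0 \<le> w e" "walk V E p" "hd p = u" "last p = v" "walk_weight w p \<le> d"
  shows "wdist V E w u v \<le> d"
proof -
  \<comment> \<open>The zero potential shows that walk weights are nonnegative. A lower bound is
    required before anything can be concluded about an infimum of reals.\<close>
  have "bdd_below {walk_weight w p |p. walk V E p \<and> hd p = u \<and> last p = v}"
    using walk_weight_potential[where k = "\<lambda>_. 0" and V = V and E = E and w = w] assms(1)
    by (intro bdd_belowI[of _ 0]) auto
  then have "wdist V E w u v \<le> walk_weight w p"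
    unfolding wdist_def by (rule cInf_lower[rotated]) (use assms in auto)
  then show ?thesis using assms by simp
qed

text \<open>Dual certificate to \<open>wdist_le\<close>: a function that grows by at most
  \<open>w\<close> along every edge bounds all walk weights from below. The walk \<open>p\<close>
  ensures that the infimum is taken over a nonempty set.\<close>

lemma wdist_ge_potential:
  assumes "\<And>u v. u \<in> V \<Longrightarrow> v \<in> V \<Longrightarrow> {u, v} \<in> E \<Longrightarrow> k v - k u \<le> w {u, v}"
    and "walk V E p" "hd p = u" "last p = v"
  shows "k v - k u \<le> wdist V E w u v"
  unfolding wdist_def
proof (rule cInf_greatest)
  show "{walk_weight w p |p. walk V E p \<and> hd p = u \<and> last p = v} \<noteq> {}"
    using assms by blast
qed (use walk_weight_potential[of V E k w] assms(1) in fastforce)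

section \<open>The shortest-path metric of a connected graph\<close>

lemma gdist_le:
  assumes "walk V E p" "hd p = u" "last p = v" 
  shows "gdist V E u v \<le> real (length p - 1)"
  using wdist_le[of E "\<lambda>_. 1", OF _ assms] by (simp add: walk_weight_one)

text \<open>With unit weights the walk weights are natural numbers, so the infimum is attained by a
  walk of least length.\<close>

lemma shortest_walk:
  assumes "connected_graph V E" "u \<in> V" "v \<in> V"
  obtains p where "walk V E p" "hd p = u" "last p = v" "gdist V E u v = real (length p - 1)"
proof -
  define Q where "Q = (\<lambda>p. walk V E p \<and> hd p = u \<and> last p = v)"
  have "\<exists>p. Q p" using assms unfolding connected_graph_def Q_def by blast
  then obtain p where p: "Q p" and min: "\<And>q. Q q \<Longrightarrow> length p \<le> length q"
    using ex_has_least_nat[of Q _ length] by blast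
  have "real (length p - 1) \<le> gdist V E u v"
    unfolding wdist_def
  proof (rule cInf_greatest)
    show "{walk_weight (\<lambda>_. 1) p |p. walk V E p \<and> hd p = u \<and> last p = v} \<noteq> {}"
      using p by (auto simp: Q_def)
  qed (use min in \<open>auto simp: Q_def walk_weight_one diff_le_mono\<close>)
  with gdist_le[of V E p u v] p that[of p] show thesis by (auto simp: Q_def)
qed

lemma gdist_nonneg:
  assumes "connected_graph V E" "u \<in> V" "v \<in> V"
  shows "0 \<le> gdist V E u v"
  using shortest_walk[OF assms] by (metis of_nat_0_le_iff)

lemma gdist_commute:
  assumes "connected_graph V E" "u \<in> V" "v \<in> V"
  shows "gdist V E u v = gdist V E v u"
proof -
  have "gdist V E u v \<le> gdist V E v u" if u: "u \<in> V" and v: "v \<in> V" for u v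
  proof -
    obtain p where p: "walk V E p" "hd p = v" "last p = u" "gdist V E v u = real (length p - 1)"
      using shortest_walk[OF assms(1) v u] .
    have "p \<noteq> []" using p by (simp add: walk_def)
    then show ?thesis
      using gdist_le[OF walk_rev[OF p(1)], of u v] p by (simp add: hd_rev last_rev)
  qed
  with assms show ?thesis by (meson order_antisym)
qed

lemma gdist_triangle:
  assumes "connected_graph V E" "u \<in> V" "v \<in> V" "x \<in> V"
  shows "gdist V E u x \<le> gdist V E u v + gdist V E v x"
proof -
  obtain p where p: "walk V E p" "hd p = u" "last p = v" "gdist V E u v = real (length p - 1)"
    using shortest_walk[OF assms(1-3)] .
  obtain q where q: "walk V E q" "hd q = v" "last q = x" "gdist V E v x = real (length q - 1)"
    using shortest_walk[OF assms(1,3,4)] .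
  have "p \<noteq> []" "q \<noteq> []" using p q by (auto simp: walk_def)
  then have "real (length (p @ tl q) - 1) = real (length p - 1) + real (length q - 1)"
    by (cases p; cases q) auto
  then show ?thesis
    using gdist_le[of V E "p @ tl q" u x] walk_append[OF p(1) q(1)] p q by simp
qed

lemma gdist_self: "u \<in> V \<Longrightarrow> connected_graph V E \<Longrightarrow> gdist V E u u = 0"
  using gdist_le[of V E "[u]" u u] gdist_nonneg[of V E u u] by simp

lemma gdist_pos:
  assumes "connected_graph V E" "u \<in> V" "v \<in> V" "u \<noteq> v"
  shows "1 \<le> gdist V E u v"
proof -
  obtain p where p: "walk V E p" "hd p = u" "last p = v" "gdist V E u v = real (length p - 1)"
    using shortest_walk[OF assms(1-3)] .
  have "length p - 1 \<noteq> 0" using p assms(4) by (cases p; cases "tl p") (auto simp: walk_def)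
  then show ?thesis using p by linarith
qed

text \<open>Every vertex of a shortest \<open>u\<close>-\<open>v\<close> walk except a possible midpoint distinguishes \<open>u\<close>
  from \<open>v\<close>.\<close>

lemma gdist_le_card_distinguishing:
  assumes "connected_graph V E" "u \<in> V" "v \<in> V"
  shows "gdist V E u v \<le> real (card {x \<in> V. gdist V E x u \<noteq> gdist V E x v})"
proof -
  obtain p where p: "walk V E p" "hd p = u" "last p = v" "gdist V E u v = real (length p - 1)"
    using shortest_walk[OF assms] .
  define k where "k = length p - 1"
  have len: "length p = Suc k" using p by (cases p) (auto simp: k_def walk_def)
  have inV: "p ! i \<in> V" if "i \<le> k" for i
    using p that len by (auto simp: walk_def)
  \<comment> \<open>The two pieces of the walk have lengths \<open>i\<close> and
    \<open>k - i\<close>, which add up to the distance of its ends. By the triangle inequality both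
    pieces are shortest.\<close>
  have dist: "gdist V E (p ! i) u = real i \<and> gdist V E (p ! i) v = real (k - i)" if "i \<le> k" for i
  proof -
    have i: "i < length p" using that len by simp
    have "gdist V E u (p ! i) \<le> real i"
      using gdist_le[OF walk_take(1)[OF p(1) i] refl refl] walk_take[OF p(1) i] p(2) i by simp
    moreover have "gdist V E (p ! i) v \<le> real (k - i)"
      using gdist_le[OF walk_drop(1)[OF p(1) i] refl refl] walk_drop[OF p(1) i] p(3) len by simp
    moreover have "gdist V E u v \<le> gdist V E u (p ! i) + gdist V E (p ! i) v"
      using gdist_triangle[OF assms(1,2) inV[OF that] assms(3)] .
    moreover have "gdist V E u v = real i + real (k - i)"
      using p(4) that by (simp add: k_def)
    moreover have "gdist V E (p ! i) u = gdist V E u (p ! i)"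
      using gdist_commute[OF assms(1) inV[OF that] assms(2)] .
    ultimately show ?thesis by linarith
  qed
  have "inj_on (\<lambda>i. p ! i) {..k}"
    by (rule inj_onI) (metis atMost_iff dist of_nat_eq_iff)
  \<comment> \<open>Equality \<open>i = k - i\<close> is possible only at
    \<open>i = k div 2\<close>. Dropping this one of the \<open>k + 1\<close> indices leaves exactly
    \<open>k\<close>.\<close>
  then have inj: "inj_on (\<lambda>i. p ! i) ({..k} - {k div 2})" by (rule inj_on_subset) auto
  have sub: "(\<lambda>i. p ! i) ` ({..k} - {k div 2}) \<subseteq> {x \<in> V. gdist V E x u \<noteq> gdist V E x v}"
    using inV dist by auto
  have "finite V" using assms(1) by (simp add: connected_graph_def graph_def)
  then have "card ({..k} - {k div 2}) \<le> card {x \<in> V. gdist V E x u \<noteq> gdist V E x v}"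
    using card_mono[OF _ sub] card_image[OF inj] by simp
  moreover have "card ({..k} - {k div 2}) = k" by simp
  ultimately show ?thesis using p(4) k_def by simp
qed

text \<open>At a vertex with different distances to \<open>u\<close> and \<open>v\<close>, the value
  of \<open>f\<close> can agree with only one of them, so the vertex counts as an error for the
  other.\<close>

lemma card_distinguishing_le_phi0:
  assumes "finite V"
  shows "card {x \<in> V. gdist V E x u \<noteq> gdist V E x v} \<le> phi0 V E f u + phi0 V E f v"
proof -
  have "{x \<in> V. gdist V E x u \<noteq> gdist V E x v}
      \<subseteq> {x \<in> V. f x \<noteq> gdist V E x u} \<union> {x \<in> V. f x \<noteq> gdist V E x v}" by auto
  then have "card {x \<in> V. gdist V E x u \<noteq> gdist V E x v}
      \<le> card ({x \<in> V. f x \<noteq> gdist V E x u} \<union> {x \<in> V. f x \<noteq> gdist V E x v})"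
    using assms by (intro card_mono) auto
  also have "\<dots> \<le> phi0 V E f u + phi0 V E f v"
    unfolding phi0_def by (rule card_Un_le)
  finally show ?thesis .
qed


section \<open>Circular coordinates\<close>

text \<open>Arc distance on a circle of circumference \<open>L\<close> that is cut open at one
  point, for coordinates between \<open>0\<close> and \<open>L\<close>.\<close>

definition circ :: "real \<Rightarrow> real \<Rightarrow> real \<Rightarrow> real" where
  "circ L s t = min \<bar>s - t\<bar> (L - \<bar>s - t\<bar>)"

lemma circ_lipschitz: "circ L s t - circ L s t' \<le> \<bar>t - t'\<bar>"
  unfolding circ_def by linarith

text \<open>The edge that closes a cycle joins position \<open>M\<close> to position
  \<open>0\<close> and has weight \<open>L - M\<close>. The inequalities make
  \<open>circ L s\<close> an admissible potential across this edge, in both directions.\<close>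

lemma circ_wrap:
  assumes "0 \<le> s" "s \<le> M" "M < L"
  shows "circ L s M - circ L s 0 \<le> L - M" "circ L s 0 - circ L s M \<le> L - M"
  using assms unfolding circ_def by linarith+

lemma circ_scale: "0 < c \<Longrightarrow> circ (L / c) (s / c) (t / c) = circ L s t / c"
proof -
  assume c: "0 < c"
  then have "\<bar>s / c - t / c\<bar> = \<bar>s - t\<bar> / c"
    by (simp flip: diff_divide_distrib)
  then have "circ (L / c) (s / c) (t / c) = min (\<bar>s - t\<bar> / c) ((L - \<bar>s - t\<bar>) / c)"
    by (simp add: circ_def diff_divide_distrib)
  also have "\<dots> = circ L s t / c"
    using c by (simp add: circ_def min_def divide_le_cancel)
  finally show ?thesis .
qed

section \<open>Distances in weighted paths and cycles\<close>

definition path_position :: "(nat set \<Rightarrow> real) \<Rightarrow> nat \<Rightarrow> real" where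
  "path_position w i = (\<Sum>j<i. w {j, Suc j})"

lemma path_position_Suc: "path_position w (Suc i) = path_position w i + w {i, Suc i}"
  by (simp add: path_position_def)

lemma path_position_mono:
  assumes "\<forall>e\<in>path_edges m. 0 < w e" "i \<le> j" "j < m"
  shows "path_position w i \<le> path_position w j"
proof -
  have "0 \<le> w {l, Suc l}" if "l < j" for l
  proof -
    have "{l, Suc l} \<in> path_edges m" using assms that by (auto simp: path_edges_def)
    then show ?thesis using assms(1) less_imp_le by blast
  qed
  then show ?thesis
    unfolding path_position_def using assms by (intro sum_mono2) auto
qed

text \<open>Any edge set \<open>F\<close> above the path edges is allowed, so that the walk can be
  reused inside the cycle.\<close>

lemma path_walk_up:
  assumes "path_edges m \<subseteq> F" "i \<le> j" "j < m"
  shows "\<exists>p. walk {..<m} F p \<and> hd p = i \<and> last p = j \<and>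
    walk_weight w p = path_position w j - path_position w i"
  using assms(2,3)
proof (induction j rule: dec_induct)
  case base
  then show ?case by (intro exI[of _ "[i]"]) auto
next
  case (step n)
  then obtain p where p: "walk {..<m} F p" "hd p = i" "last p = n"
    "walk_weight w p = path_position w n - path_position w i" by auto
  have "{n, Suc n} \<in> F" using assms(1) step by (auto simp: path_edges_def)
  then have q: "walk {..<m} F [n, Suc n]" using step by (auto simp: walk_Cons_Cons)
  have "p \<noteq> []" using p by (simp add: walk_def)
  then show ?case
    using walk_append[OF p(1) q] walk_weight_append[of p "[n, Suc n]" w] p
    by (intro exI[of _ "p @ tl [n, Suc n]"]) (simp add: path_position_Suc walk_weight_Cons_Cons)
qed

lemma path_walk_down:
  assumes "path_edges m \<subseteq> F" "i \<le> j" "j < m"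
  shows "\<exists>p. walk {..<m} F p \<and> hd p = j \<and> last p = i \<and>
    walk_weight w p = path_position w j - path_position w i"
  using assms(2,3)
proof (induction j rule: dec_induct)
  case base
  then show ?case by (intro exI[of _ "[i]"]) auto
next
  case (step n)
  then obtain p where p: "walk {..<m} F p" "hd p = n" "last p = i"
    "walk_weight w p = path_position w n - path_position w i" by auto
  have "{Suc n, n} \<in> F" using assms(1) step by (auto simp: path_edges_def insert_commute)
  then have q: "walk {..<m} F [Suc n, n]" using step by (auto simp: walk_Cons_Cons)
  have "p \<noteq> []" using p by (simp add: walk_def)
  then show ?case
    using walk_append[OF q p(1)] walk_weight_append[of "[Suc n, n]" p w] p
    by (intro exI[of _ "[Suc n, n] @ tl p"])
      (simp add: path_position_Suc walk_weight_Cons_Cons insert_commute)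
qed

lemma path_walk:
  assumes "path_edges m \<subseteq> F" "i < m" "j < m" "\<forall>e\<in>path_edges m. 0 < w e"
  shows "\<exists>p. walk {..<m} F p \<and> hd p = i \<and> last p = j \<and>
    walk_weight w p = \<bar>path_position w i - path_position w j\<bar>"
proof (cases "i \<le> j")
  case True
  then show ?thesis
    using path_walk_up[OF assms(1) True assms(3), of w] path_position_mono[OF assms(4) True assms(3)]
    by auto
next
  case False
  then have "j \<le> i" by simp
  then show ?thesis
    using path_walk_down[OF assms(1) _ assms(2), of j w] path_position_mono[OF assms(4) _ assms(2), of j]
    by auto
qed

text \<open>The straight walk gives the upper bound; the potential that measures the position
  relative to \<open>i\<close> gives the lower bound.\<close>

lemma path_wdist:
  assumes "\<forall>e\<in>path_edges m. 0 < w e" "i < m" "j < m"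
  shows "wdist {..<m} (path_edges m) w i j = \<bar>path_position w i - path_position w j\<bar>"
proof (rule antisym)
  obtain p where p: "walk {..<m} (path_edges m) p" "hd p = i" "last p = j"
    "walk_weight w p = \<bar>path_position w i - path_position w j\<bar>"
    using path_walk[OF order_refl assms(2,3,1)] by blast
  show "wdist {..<m} (path_edges m) w i j \<le> \<bar>path_position w i - path_position w j\<bar>"
    using assms(1) p by (intro wdist_le[OF _ p(1-3)]) (auto intro: less_imp_le)
  define k where "k y = \<bar>path_position w i - path_position w y\<bar>" for y
  have "k v - k u \<le> w {u, v}" if e: "{u, v} \<in> path_edges m" for u v
  proof -
    have "v = Suc u \<or> u = Suc v" using e by (auto simp: path_edges_def doubleton_eq_iff)
    moreover have "0 < w {u, v}" using assms(1) e by blast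
    ultimately show ?thesis
      by (auto simp: k_def path_position_Suc insert_commute)
  qed
  then have "k j - k i \<le> wdist {..<m} (path_edges m) w i j"
    by (intro wdist_ge_potential[OF _ p(1-3)]) auto
  then show "\<bar>path_position w i - path_position w j\<bar> \<le> wdist {..<m} (path_edges m) w i j"
    by (simp add: k_def)
qed

lemma cycle_wdist:
  assumes pos: "\<forall>e\<in>cycle_edges m. 0 < w e" and m: "3 \<le> m" and i: "i < m" and j: "j < m"
  defines "L \<equiv> path_position w (m - 1) + w {m - 1, 0}"
  shows "wdist {..<m} (cycle_edges m) w i j = circ L (path_position w i) (path_position w j)"
proof (rule antisym)
  have sub: "path_edges m \<subseteq> cycle_edges m" by (auto simp: cycle_edges_def)
  have pos': "\<forall>e\<in>path_edges m. 0 < w e" using pos sub by auto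
  have wm: "0 < w {m - 1, 0}" using pos by (simp add: cycle_edges_def)
  have nonneg: "0 \<le> w e" if "e \<in> cycle_edges m" for e using pos that by (simp add: less_imp_le)
  have p0: "path_position w 0 = 0" by (simp add: path_position_def)
  have range: "0 \<le> path_position w y \<and> path_position w y \<le> path_position w (m - 1)" if "y < m" for y
    using path_position_mono[OF pos', of 0 y] path_position_mono[OF pos', of y "m - 1"] that p0 by auto
  obtain p where p: "walk {..<m} (cycle_edges m) p" "hd p = i" "last p = j"
    "walk_weight w p = \<bar>path_position w i - path_position w j\<bar>"
    using path_walk[OF sub i j pos'] by blast
  have 1: "wdist {..<m} (cycle_edges m) w i j \<le> \<bar>path_position w i - path_position w j\<bar>"
    by (intro wdist_le[OF nonneg p(1-3)]) (auto simp: p(4))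
  \<comment> \<open>The long way around: from \<open>c\<close> down to \<open>0\<close>, over the
    closing edge to \<open>m - 1\<close>, and down to \<open>d\<close>, or the reverse of this.
    Taking the endpoint with the smaller position as \<open>c\<close> covers both orders of
    \<open>i\<close> and \<open>j\<close>.\<close>
  have around: "\<exists>q. walk {..<m} (cycle_edges m) q \<and> hd q = a \<and> last q = b \<and>
      walk_weight w q = path_position w c + w {m - 1, 0} + (path_position w (m - 1) - path_position w d)"
    if cd: "c < m" "d < m" and "a = c \<and> b = d \<or> a = d \<and> b = c" for a b c d
  proof -
    have m1: "m - 1 < m" and m0: "0 < m" using m by auto
    from that(3) show ?thesis
    proof
      assume ab: "a = c \<and> b = d"
      obtain q1 where q1: "walk {..<m} (cycle_edges m) q1" "hd q1 = c" "last q1 = 0"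
        "walk_weight w q1 = path_position w c"
        using path_walk[OF sub cd(1) m0 pos'] range[OF cd(1)] p0 by auto
      obtain q2 where q2: "walk {..<m} (cycle_edges m) q2" "hd q2 = m - 1" "last q2 = d"
        "walk_weight w q2 = path_position w (m - 1) - path_position w d"
        using path_walk[OF sub m1 cd(2) pos'] range[OF cd(2)] by auto
      have e: "walk {..<m} (cycle_edges m) [0, m - 1]"
        using m by (auto simp: walk_Cons_Cons cycle_edges_def insert_commute)
      have e_q2: "walk {..<m} (cycle_edges m) ([0, m - 1] @ tl q2)"
        "hd ([0, m - 1] @ tl q2) = 0" "last ([0, m - 1] @ tl q2) = d"
        using walk_append[OF e q2(1)] q2 by auto
      have "q1 \<noteq> []" "q2 \<noteq> []" using q1 q2 by (auto simp: walk_def)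
      then have "walk_weight w (q1 @ tl ([0, m - 1] @ tl q2)) =
          path_position w c + (w {0, m - 1} + (path_position w (m - 1) - path_position w d))"
        using walk_weight_append[of "[0, m - 1]" q2 w] walk_weight_append[of q1 "[0, m - 1] @ tl q2" w]
          q1 q2 by (simp add: walk_weight_Cons_Cons)
      then show ?thesis
        using walk_append[OF q1(1) e_q2(1)] e_q2 q1 ab
        by (intro exI[of _ "q1 @ tl ([0, m - 1] @ tl q2)"]) (simp add: insert_commute)
    next
      assume ab: "a = d \<and> b = c"
      obtain q1 where q1: "walk {..<m} (cycle_edges m) q1" "hd q1 = 0" "last q1 = c"
        "walk_weight w q1 = path_position w c"
        using path_walk[OF sub m0 cd(1) pos'] range[OF cd(1)] p0 by auto
      obtain q2 where q2: "walk {..<m} (cycle_edges m) q2" "hd q2 = d" "last q2 = m - 1"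
        "walk_weight w q2 = path_position w (m - 1) - path_position w d"
        using path_walk[OF sub cd(2) m1 pos'] range[OF cd(2)] by auto
      have e: "walk {..<m} (cycle_edges m) [m - 1, 0]"
        using m by (auto simp: walk_Cons_Cons cycle_edges_def)
      have e_q1: "walk {..<m} (cycle_edges m) ([m - 1, 0] @ tl q1)"
        "hd ([m - 1, 0] @ tl q1) = m - 1" "last ([m - 1, 0] @ tl q1) = c"
        using walk_append[OF e q1(1)] q1 by auto
      have "q1 \<noteq> []" "q2 \<noteq> []" using q1 q2 by (auto simp: walk_def)
      then have "walk_weight w (q2 @ tl ([m - 1, 0] @ tl q1)) =
          path_position w (m - 1) - path_position w d + (w {m - 1, 0} + path_position w c)"
        using walk_weight_append[of "[m - 1, 0]" q1 w] walk_weight_append[of q2 "[m - 1, 0] @ tl q1" w]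
          q1 q2 by (simp add: walk_weight_Cons_Cons)
      then show ?thesis
        using walk_append[OF q2(1) e_q1(1)] e_q1 q2 ab
        by (intro exI[of _ "q2 @ tl ([m - 1, 0] @ tl q1)"]) simp
    qed
  qed
  obtain q where q: "walk {..<m} (cycle_edges m) q" "hd q = i" "last q = j"
    "walk_weight w q = L - \<bar>path_position w i - path_position w j\<bar>"
  proof (cases "path_position w i \<le> path_position w j")
    case True
    then show thesis using around[OF i j, of i j] that by (auto simp: L_def)
  next
    case False
    then show thesis using around[OF j i, of i j] that by (auto simp: L_def)
  qed
  have "wdist {..<m} (cycle_edges m) w i j \<le> L - \<bar>path_position w i - path_position w j\<bar>"
    by (intro wdist_le[OF nonneg q(1-3)]) (auto simp: q(4))
  with 1 show "wdist {..<m} (cycle_edges m) w i j \<le> circ L (path_position w i) (path_position w j)"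
    by (simp add: circ_def)
  \<comment> \<open>The arc distance from \<open>i\<close> is the potential for the lower bound:
    path edges are handled by the Lipschitz property, the closing edge by
    \<open>circ_wrap\<close>.\<close>
  define k where "k y = circ L (path_position w i) (path_position w y)" for y
  have "k v - k u \<le> w {u, v}" if e: "{u, v} \<in> cycle_edges m" for u v
  proof -
    consider "v = Suc u" | "u = Suc v" | "u = 0" "v = m - 1" | "v = 0" "u = m - 1"
      using e by (auto simp: cycle_edges_def path_edges_def doubleton_eq_iff)
    moreover have "0 < w {u, v}" using pos e by blast
    ultimately show ?thesis
    proof cases
      case 1
      then show ?thesis
        using circ_lipschitz[of L "path_position w i" "path_position w v" "path_position w u"]
          \<open>0 < w {u, v}\<close> by (simp add: k_def path_position_Suc)
    next
      case 2
      then have "{u, v} = {v, Suc v}" by auto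
      with 2 show ?thesis
        using circ_lipschitz[of L "path_position w i" "path_position w v" "path_position w u"]
          \<open>0 < w {u, v}\<close> by (simp add: k_def path_position_Suc)
    next
      case 3
      then have "w {u, v} = L - path_position w (m - 1)" by (simp add: L_def insert_commute)
      with 3 show ?thesis
        using circ_wrap(1)[of "path_position w i" "path_position w (m - 1)" L] range[OF i] p0 wm
        by (simp add: k_def L_def)
    next
      case 4
      then have "w {u, v} = L - path_position w (m - 1)" by (simp add: L_def)
      with 4 show ?thesis
        using circ_wrap(2)[of "path_position w i" "path_position w (m - 1)" L] range[OF i] p0 wm
        by (simp add: k_def L_def)
    qed
  qed
  then have "k j - k i \<le> wdist {..<m} (cycle_edges m) w i j"
    by (intro wdist_ge_potential[OF _ p(1-3)]) auto
  moreover have "k i = 0" using range[OF i] wm by (simp add: k_def circ_def L_def)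
  ultimately show "circ L (path_position w i) (path_position w j) \<le> wdist {..<m} (cycle_edges m) w i j"
    by (simp add: k_def)
qed

text \<open>A common normal form of both kinds of embedding: a map into a circle of circumference
  \<open>L\<close> that never contracts and expands by at most \<rho>. The range condition makes
  \<open>circ\<close> the true arc distance.\<close>

definition circular_coordinate ::
  "'a set \<Rightarrow> 'a edges \<Rightarrow> real \<Rightarrow> real \<Rightarrow> ('a \<Rightarrow> real) \<Rightarrow> bool" where
  "circular_coordinate V E \<rho> L q \<longleftrightarrow> (\<forall>x\<in>V. 0 \<le> q x \<and> q x \<le> L) \<and>
     (\<forall>x\<in>V. \<forall>y\<in>V. gdist V E x y \<le> circ L (q x) (q y) \<and>
        circ L (q x) (q y) \<le> \<rho> * gdist V E x y)"

text \<open>Dividing the positions and the circumference by the scaling factor \<open>c\<close> of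
  the distortion leaves a map with lower factor 1 and upper factor \<rho>.\<close>

lemma circular_coordinate_if_distortion:
  assumes "distortion_at_most V (gdist V E) Y d \<tau> \<rho>"
    and d: "\<And>i j. i \<in> Y \<Longrightarrow> j \<in> Y \<Longrightarrow> d i j = circ L (h i) (h j)"
    and h: "\<And>i. i \<in> Y \<Longrightarrow> 0 \<le> h i \<and> h i \<le> L"
  shows "\<exists>L q. circular_coordinate V E \<rho> L q"
proof -
  from assms(1) obtain c where c: "0 < c" and \<tau>: "\<tau> ` V \<subseteq> Y"
    and dist: "\<And>x y. x \<in> V \<Longrightarrow> y \<in> V \<Longrightarrow> c * gdist V E x y \<le> d (\<tau> x) (\<tau> y) \<and>
      d (\<tau> x) (\<tau> y) \<le> c * \<rho> * gdist V E x y"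
    unfolding distortion_at_most_def by blast
  have "circular_coordinate V E \<rho> (L / c) (\<lambda>x. h (\<tau> x) / c)"
    unfolding circular_coordinate_def circ_scale[OF c]
  proof (intro conjI ballI)
    fix x assume "x \<in> V"
    then show "0 \<le> h (\<tau> x) / c" "h (\<tau> x) / c \<le> L / c"
      using h[of "\<tau> x"] \<tau> c by (auto simp: divide_right_mono)
  next
    fix x y assume xy: "x \<in> V" "y \<in> V"
    then have "d (\<tau> x) (\<tau> y) = circ L (h (\<tau> x)) (h (\<tau> y))" using d \<tau> by blast
    then show "gdist V E x y \<le> circ L (h (\<tau> x)) (h (\<tau> y)) / c"
      "circ L (h (\<tau> x)) (h (\<tau> y)) / c \<le> \<rho> * gdist V E x y"
      using dist[OF xy] c by (auto simp: field_simps)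
  qed
  then show ?thesis by blast
qed

lemma circular_coordinate_exists:
  assumes "embeds_in_weighted_path V E \<rho> \<or> embeds_in_weighted_cycle V E \<rho>"
  shows "\<exists>L q. circular_coordinate V E \<rho> L q"
  using assms
proof
  assume "embeds_in_weighted_path V E \<rho>"
  then obtain m w \<tau> where m: "1 \<le> m" and pos: "\<forall>e\<in>path_edges m. 0 < w e"
    and dist: "distortion_at_most V (gdist V E) {..<m} (wdist {..<m} (path_edges m) w) \<tau> \<rho>"
    unfolding embeds_in_weighted_path_def by blast
  \<comment> \<open>A path closed up by an edge as long as the path itself: going around never helps.\<close>
  define L where "L = 2 * path_position w (m - 1)"
  have range: "0 \<le> path_position w i \<and> path_position w i \<le> path_position w (m - 1)" if "i < m" for i
    using path_position_mono[OF pos, of 0 i] path_position_mono[OF pos, of i "m - 1"] that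
    by (auto simp: path_position_def)
  show ?thesis
  proof (rule circular_coordinate_if_distortion[OF dist])
    fix i j assume "i \<in> {..<m}" "j \<in> {..<m}"
    then show "wdist {..<m} (path_edges m) w i j = circ L (path_position w i) (path_position w j)"
      using path_wdist[OF pos, of i j] range[of i] range[of j] by (auto simp: circ_def L_def)
  qed (use range in \<open>fastforce simp: L_def\<close>)
next
  assume "embeds_in_weighted_cycle V E \<rho>"
  then obtain m w \<tau> where m: "3 \<le> m" and pos: "\<forall>e\<in>cycle_edges m. 0 < w e"
    and dist: "distortion_at_most V (gdist V E) {..<m} (wdist {..<m} (cycle_edges m) w) \<tau> \<rho>"
    unfolding embeds_in_weighted_cycle_def by blast
  have pos': "\<forall>e\<in>path_edges m. 0 < w e" using pos by (auto simp: cycle_edges_def)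
  have wm: "0 < w {m - 1, 0}" using pos by (simp add: cycle_edges_def)
  show ?thesis
  proof (rule circular_coordinate_if_distortion[OF dist])
    fix i assume "i \<in> {..<m}"
    then have "i < m" "i \<le> m - 1" "m - 1 < m" by auto
    then show "0 \<le> path_position w i \<and>
        path_position w i \<le> path_position w (m - 1) + w {m - 1, 0}"
      using path_position_mono[OF pos', of 0 i] path_position_mono[OF pos', of i "m - 1"] wm
      by (auto simp: path_position_def[of _ 0])
  qed (use cycle_wdist[OF pos m] in auto)
qed


section \<open>Steiner trees\<close>

lemma tree_singleton: "tree {x} {}"
proof -
  have "connected_graph {x} {}"
    by (auto simp: connected_graph_def graph_def intro!: exI[of _ "[x]"])
  moreover have "\<not> is_cycle {x} {} p" for p
    using walk_nth_edge[of "{x}" "{}" p 0] by (auto simp: is_cycle_def)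
  ultimately show ?thesis by (simp add: tree_def)
qed

lemma connected_graph_leaf:
  assumes "connected_graph T F" "x \<in> T" "y \<notin> T"
  shows "connected_graph (insert y T) (insert {x, y} F)"
proof -
  let ?T = "insert y T" and ?F = "insert {x, y} F"
  have old: "\<exists>p. walk ?T ?F p \<and> hd p = u \<and> last p = v" if "u \<in> T" "v \<in> T" for u v
    using assms(1) that walk_mono[of T F _ ?T ?F] unfolding connected_graph_def by blast
  have xy: "walk ?T ?F [x, y]" "walk ?T ?F [y, x]"
    using assms by (auto simp: walk_Cons_Cons insert_commute)
  have "\<exists>p. walk ?T ?F p \<and> hd p = u \<and> last p = v" if uv: "u \<in> ?T" "v \<in> ?T" for u v
  proof -
    consider "u \<in> T" "v \<in> T" | "u = y" "v = y" | "u = y" "v \<in> T" | "u \<in> T" "v = y"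
      using uv by blast
    then show ?thesis
    proof cases
      case 2
      then show ?thesis by (intro exI[of _ "[y]"]) simp
    next
      case 3
      then obtain p where "walk ?T ?F p" "hd p = x" "last p = v" using old[OF assms(2)] by blast
      with 3 show ?thesis using walk_append[OF xy(2), of p] by (intro exI[of _ "[y, x] @ tl p"]) simp
    next
      case 4
      then obtain p where "walk ?T ?F p" "hd p = u" "last p = x" using old[OF _ assms(2)] by blast
      with 4 show ?thesis using walk_append[OF _ xy(1), of p] by (intro exI[of _ "p @ tl [x, y]"]) simp
    qed (use old in blast)
  qed
  moreover have "graph ?T ?F"
    using assms unfolding connected_graph_def graph_def by blast
  ultimately show ?thesis by (auto simp: connected_graph_def)
qed

text \<open>A cycle that avoids \<open>y\<close> lies in the old tree. On a cycle through
  \<open>y\<close> both neighbours of \<open>y\<close> would be \<open>x\<close>, but a cycle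
  repeats no vertex apart from its ends.\<close>

lemma tree_leaf:
  assumes "tree T F" "x \<in> T" "y \<notin> T"
  shows "tree (insert y T) (insert {x, y} F)"
proof -
  let ?T = "insert y T" and ?F = "insert {x, y} F"
  have conn: "connected_graph T F" and acyc: "\<And>p. \<not> is_cycle T F p"
    using assms(1) by (auto simp: tree_def)
  have FT: "e \<subseteq> T" if "e \<in> F" for e
    using conn that by (auto simp: connected_graph_def graph_def)
  have nb: "a = x" if "{a, y} \<in> ?F" for a
    using that FT[of "{a, y}"] assms(3) by (auto simp: doubleton_eq_iff)
  have "\<not> is_cycle ?T ?F p" for p
  proof
    assume cyc: "is_cycle ?T ?F p"
    then have p: "walk ?T ?F p" "hd p = last p" "distinct (tl p)" "4 \<le> length p"
      by (auto simp: is_cycle_def)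
    define k where "k = length p"
    have ends: "p ! 0 = p ! (k - 1)"
      using p by (metis hd_conv_nth k_def last_conv_nth list.size(3) not_numeral_le_zero)
    have inj: "a = b" if "p ! a = p ! b" "1 \<le> a" "1 \<le> b" "a < k" "b < k" for a b
    proof -
      have "a - 1 = b - 1"
        using that nth_eq_iff_index_eq[OF p(3), of "a - 1" "b - 1"] by (simp add: nth_tl k_def)
      then show ?thesis using that by simp
    qed
    show False
    proof (cases "y \<in> set p")
      case False
      have "{p ! i, p ! Suc i} \<in> F" if "Suc i < length p" for i
      proof -
        have "p ! i \<in> set p" "p ! Suc i \<in> set p" using that by auto
        then have "{p ! i, p ! Suc i} \<noteq> {x, y}" using False by (auto simp: doubleton_eq_iff)
        then show ?thesis using walk_nth_edge[OF p(1) that] by simp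
      qed
      then have "walk T F p"
        using p(1) False by (auto simp: walk_def successively_conv_nth)
      with acyc p show False by (auto simp: is_cycle_def)
    next
      case True
      then obtain j0 where "j0 < k" "p ! j0 = y" by (auto simp: in_set_conv_nth k_def)
      \<comment> \<open>Only the tail of \<open>p\<close> is distinct, so an occurrence at index 0
        is traded for the equal last entry.\<close>
      moreover define j where "j = (if j0 = 0 then k - 1 else j0)"
      ultimately have j: "1 \<le> j" "j < k" "p ! j = y"
        using ends p(4) by (auto simp: k_def)
      have "{p ! (j - 1), y} \<in> ?F"
        using walk_nth_edge[OF p(1), of "j - 1"] j by (simp add: k_def)
      then have prev: "p ! (j - 1) = x" by (rule nb)
      \<comment> \<open>The predecessor and the successor of \<open>y\<close> on the cycle are the
        same vertex \<open>x\<close>. The case split is due to indices \<open>0\<close> and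
        \<open>k - 1\<close> being the same point of the cycle; in the two boundary cases the length
        of at least 4 yields the contradiction.\<close>
      show False
      proof (cases "j = k - 1")
        case True
        then have "p ! 0 = y" using ends j by simp
        then have "{p ! 1, y} \<in> ?F"
          using walk_nth_edge[OF p(1), of 0] p(4) by (simp add: insert_commute)
        then have "p ! 1 = x" by (rule nb)
        then have "1 = j - 1" using prev True p(4) by (intro inj) (auto simp: k_def)
        then show False using True p(4) by (simp add: k_def)
      next
        case False
        then have "{p ! Suc j, y} \<in> ?F"
          using walk_nth_edge[OF p(1), of j] j by (simp add: insert_commute k_def)
        then have succ: "p ! Suc j = x" by (rule nb)
        show False
        proof (cases "j = 1")
          case True
          then have "p ! (k - 1) = p ! 2" using prev succ ends by (simp add: numeral_2_eq_2)
          then have "k - 1 = 2" using p(4) by (intro inj) (auto simp: k_def)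
          then show False using p(4) by (simp add: k_def)
        next
          case False
          then have "j - 1 = Suc j" using prev succ j \<open>j \<noteq> k - 1\<close> by (intro inj) auto
          then show False by simp
        qed
      qed
    qed
  qed
  with connected_graph_leaf[OF conn assms(2,3)] show ?thesis by (simp add: tree_def)
qed

section \<open>Growing trees along walks and sweeps\<close>

lemma tree_finite_edges:
  assumes "tree T F"
  shows "finite F"
proof -
  have "F \<subseteq> Pow T" "finite T" using assms by (auto simp: tree_def connected_graph_def graph_def)
  then show ?thesis by (meson finite_Pow_iff finite_subset)
qed

text \<open>A step of the walk inside the tree is free, and a step to a new vertex attaches it as a
  leaf at the current vertex. So each step adds at most one edge.\<close>

lemma tree_absorb_walk:
  assumes "tree T F" "T \<subseteq> V" "F \<subseteq> E" "walk V E p" "hd p \<in> T"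
  shows "\<exists>T' F'. tree T' F' \<and> T' \<subseteq> V \<and> F' \<subseteq> E \<and> T \<union> set p \<subseteq> T' \<and>
    card F' \<le> card F + (length p - 1)"
  using assms
proof (induction p arbitrary: T F rule: induct_list012)
  case 1
  then show ?case by (simp add: walk_def)
next
  case (2 x)
  then show ?case by auto
next
  case (3 x y zs)
  have yV: "y \<in> V" using 3(6) by (auto simp: walk_def)
  have yzs: "walk V E (y # zs)" "{x, y} \<in> E" using 3(6) by (auto simp: walk_Cons_Cons)
  show ?case
  proof (cases "y \<in> T")
    case True
    then obtain T' F' where "tree T' F'" "T' \<subseteq> V" "F' \<subseteq> E" "T \<union> set (y # zs) \<subseteq> T'"
      "card F' \<le> card F + (length (y # zs) - 1)"
      using 3(2)[OF 3(3-5) yzs(1)] by auto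
    with 3 show ?thesis by (intro exI[of _ T'] exI[of _ F']) auto
  next
    case False
    have "tree (insert y T) (insert {x, y} F)" using tree_leaf[of T F x y] False 3 by simp
    then obtain T' F' where "tree T' F'" "T' \<subseteq> V" "F' \<subseteq> E" "insert y T \<union> set (y # zs) \<subseteq> T'"
      "card F' \<le> card (insert {x, y} F) + (length (y # zs) - 1)"
      using 3(2)[OF _ _ _ yzs(1), of "insert y T" "insert {x, y} F"] 3(4,5) yV yzs(2) by auto
    moreover have "card (insert {x, y} F) \<le> Suc (card F)"
      by (metis card_insert_if le_SucI order_refl tree_finite_edges[OF 3(3)])
    ultimately show ?thesis using 3 by (intro exI[of _ T'] exI[of _ F']) auto
  qed
qed

text \<open>Connect the vertices of \<open>A\<close> in order of increasing \<open>h\<close>, each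
  to its predecessor by a shortest walk. The walk lengths telescope to the largest value of
  \<open>h\<close>.\<close>

lemma tree_sweep:
  assumes conn: "connected_graph V E" and tr: "tree T F" "T \<subseteq> V" "F \<subseteq> E"
    and u: "u \<in> T" "u \<in> A" "h u = 0" and A: "A \<subseteq> V"
    and h: "\<And>x. x \<in> A \<Longrightarrow> 0 \<le> h x \<and> h x \<le> H"
    and d: "\<And>x y. x \<in> A \<Longrightarrow> y \<in> A \<Longrightarrow> gdist V E x y \<le> \<bar>h x - h y\<bar>"
  shows "\<exists>T' F'. tree T' F' \<and> T' \<subseteq> V \<and> F' \<subseteq> E \<and> T \<union> A \<subseteq> T' \<and> real (card F') \<le> real (card F) + H"
proof -
  have fin: "finite A" using conn A by (auto simp: connected_graph_def graph_def intro: finite_subset)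
  \<comment> \<open>Here \<open>z\<close> is the vertex reached last, or \<open>u\<close> at the
    start. The ranking induction inserts vertices in nondecreasing order of \<open>h\<close>, so the
    next walk has length at most \<open>h x - h z\<close>.\<close>
  have sweep: "S \<subseteq> A \<Longrightarrow> \<exists>T' F' z. tree T' F' \<and> T' \<subseteq> V \<and> F' \<subseteq> E \<and> T \<union> S \<subseteq> T' \<and>
      z \<in> insert u S \<and> real (card F') \<le> real (card F) + h z" if "finite S" for S
    using that
  proof (induction S rule: finite_ranking_induct[where f = h])
    case empty
    then show ?case using tr u by (intro exI[of _ T] exI[of _ F] exI[of _ u]) simp
  next
    case (insert x S)
    then obtain T' F' z where T': "tree T' F'" "T' \<subseteq> V" "F' \<subseteq> E" "T \<union> S \<subseteq> T'"
      "z \<in> insert u S" "real (card F') \<le> real (card F) + h z" by auto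
    have zx: "z \<in> A" "x \<in> A" "z \<in> T'" "h z \<le> h x" using insert T' u h by auto
    then obtain p where p: "walk V E p" "hd p = z" "last p = x" "gdist V E z x = real (length p - 1)"
      using shortest_walk[OF conn, of z x] A by blast
    obtain T'' F'' where T'': "tree T'' F''" "T'' \<subseteq> V" "F'' \<subseteq> E" "T' \<union> set p \<subseteq> T''"
      "card F'' \<le> card F' + (length p - 1)"
      using tree_absorb_walk[OF T'(1-3) p(1)] p zx by auto
    have "p \<noteq> []" using p by (simp add: walk_def)
    then have "x \<in> T''" using p T'' by auto
    moreover have "real (card F'') \<le> real (card F) + h x"
    proof -
      have "real (length p - 1) \<le> h x - h z" using d[OF zx(1,2)] zx p by simp
      moreover have "real (card F'') \<le> real (card F') + real (length p - 1)"
        using T''(5) by linarith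
      ultimately show ?thesis using T'(6) by linarith
    qed
    ultimately show ?case
      using T'' T' by (intro exI[of _ T''] exI[of _ F''] exI[of _ x]) auto
  qed
  obtain T' F' z where T': "tree T' F'" "T' \<subseteq> V" "F' \<subseteq> E" "T \<union> A \<subseteq> T'" "z \<in> insert u A"
    "real (card F') \<le> real (card F) + h z"
    using sweep[OF fin order_refl] by auto
  moreover have "h z \<le> H" using T'(5) u h by auto
  ultimately show ?thesis by (intro exI[of _ T'] exI[of _ F']) auto
qed

text \<open>Starting from any terminal \<open>u\<close>, one sweep in each direction of the circle reaches the
  terminals that are closest in that direction.\<close>

lemma steiner_tree_bound:
  assumes conn: "connected_graph V E" and q: "circular_coordinate V E \<rho> L q"
    and W: "W \<subseteq> V" "W \<noteq> {}" and \<rho>: "0 \<le> \<rho>"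
    and diam: "\<forall>x\<in>W. \<forall>y\<in>W. gdist V E x y \<le> D"
  shows "\<exists>T F. steiner_tree V E W T F \<and> real (card F) \<le> 2 * \<rho> * D"
proof -
  obtain u where u: "u \<in> W" using W by blast
  then have uV: "u \<in> V" using W by blast
  have range: "0 \<le> q x \<and> q x \<le> L" if "x \<in> V" for x
    using q that by (simp add: circular_coordinate_def)
  have circ: "gdist V E x y \<le> circ L (q x) (q y)" "circ L (q x) (q y) \<le> \<rho> * gdist V E x y"
    if "x \<in> V" "y \<in> V" for x y
    using q that by (auto simp: circular_coordinate_def)
  \<comment> \<open>\<open>h1\<close> is the distance travelled from \<open>u\<close> in the
    direction of increasing coordinates, \<open>h2\<close> that in the opposite direction. Vertices
    at the coordinate of \<open>u\<close> get \<open>0\<close> rather than a full turn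
    \<open>L\<close>. \<open>A1\<close> and \<open>A2\<close> collect the terminals for which the
    respective direction is a shortest arc.\<close>
  define h1 where "h1 x = (if q u \<le> q x then q x - q u else L + q x - q u)" for x
  define h2 where "h2 x = (if q x = q u then 0 else L - h1 x)" for x
  define A1 where "A1 = {x \<in> W. h1 x \<le> circ L (q u) (q x)}"
  define A2 where "A2 = {x \<in> W. h2 x \<le> circ L (q u) (q x)}"
  have cover: "W \<subseteq> A1 \<union> A2"
    using range[OF uV] by (auto simp: A1_def A2_def h1_def h2_def circ_def)
  \<comment> \<open>This is where the distortion enters: each of the two sweeps ends within arc
    length \<rho> times \<open>D\<close> of \<open>u\<close>.\<close>
  have le: "circ L (q u) (q x) \<le> \<rho> * D" if "x \<in> W" for x
  proof -
    have "\<rho> * gdist V E u x \<le> \<rho> * D" using diam u that \<rho> by (intro mult_left_mono) auto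
    moreover have "x \<in> V" using that W by blast
    ultimately show ?thesis using circ(2)[OF uV, of x] by linarith
  qed
  have sweep1: "\<exists>T' F'. tree T' F' \<and> T' \<subseteq> V \<and> F' \<subseteq> E \<and> {u} \<union> A1 \<subseteq> T' \<and>
      real (card F') \<le> real (card ({} :: 'a edges)) + \<rho> * D"
  proof (rule tree_sweep[OF conn tree_singleton, where u = u and h = h1])
    show "u \<in> A1" using u range[OF uV] by (simp add: A1_def h1_def circ_def)
    show "h1 u = 0" by (simp add: h1_def)
    show "0 \<le> h1 x \<and> h1 x \<le> \<rho> * D" if "x \<in> A1" for x
      using that le[of x] W range[of x] range[OF uV] by (auto simp: A1_def h1_def)
    show "gdist V E x y \<le> \<bar>h1 x - h1 y\<bar>" if "x \<in> A1" "y \<in> A1" for x y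
    proof -
      have xy: "x \<in> V" "y \<in> V" using that W by (auto simp: A1_def)
      \<comment> \<open>The right-hand side is the length of one of the two arcs between the points,
        hence at least the shorter one.\<close>
      have "circ L (q x) (q y) \<le> \<bar>h1 x - h1 y\<bar>"
        using range[OF xy(1)] range[OF xy(2)] range[OF uV] by (auto simp: h1_def circ_def)
      then show ?thesis using circ(1)[OF xy] by linarith
    qed
  qed (use u W uV in \<open>auto simp: A1_def\<close>)
  then obtain T F where T: "tree T F" "T \<subseteq> V" "F \<subseteq> E" "{u} \<union> A1 \<subseteq> T" "real (card F) \<le> \<rho> * D"
    by auto
  have "\<exists>T' F'. tree T' F' \<and> T' \<subseteq> V \<and> F' \<subseteq> E \<and> T \<union> A2 \<subseteq> T' \<and>
      real (card F') \<le> real (card F) + \<rho> * D"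
  \<comment> \<open>The second sweep extends the tree of the first, so the result is again a tree
    and the two costs add.\<close>
  proof (rule tree_sweep[OF conn T(1-3), where u = u and h = h2])
    show "u \<in> A2" using u range[OF uV] by (simp add: A2_def h2_def circ_def)
    show "h2 u = 0" by (simp add: h2_def)
    show "0 \<le> h2 x \<and> h2 x \<le> \<rho> * D" if "x \<in> A2" for x
      using that le[of x] W range[of x] range[OF uV] by (auto simp: A2_def h1_def h2_def)
    show "gdist V E x y \<le> \<bar>h2 x - h2 y\<bar>" if "x \<in> A2" "y \<in> A2" for x y
    proof -
      have xy: "x \<in> V" "y \<in> V" using that W by (auto simp: A2_def)
      have "circ L (q x) (q y) \<le> \<bar>h2 x - h2 y\<bar>"
        using range[OF xy(1)] range[OF xy(2)] range[OF uV] by (auto simp: h1_def h2_def circ_def)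
      then show ?thesis using circ(1)[OF xy] by linarith
    qed
  qed (use T W in \<open>auto simp: A2_def\<close>)
  then obtain T' F' where T': "tree T' F'" "T' \<subseteq> V" "F' \<subseteq> E" "T \<union> A2 \<subseteq> T'"
    "real (card F') \<le> real (card F) + \<rho> * D" by auto
  have "steiner_tree V E W T' F'"
    using T' T cover unfolding steiner_tree_def by blast
  moreover have "real (card F') \<le> 2 * \<rho> * D" using T' T by linarith
  ultimately show ?thesis by blast
qed

text \<open>The arcs of the tour are distinct, and every edge carries at most two arcs.\<close>

lemma euler_tour_length:
  assumes "tree T F" "euler_tour T F t"
  shows "length t - 1 \<le> 2 * card F"
proof -
  have fin: "finite F" using tree_finite_edges[OF assms(1)] .
  have "length t - 1 = card (set (walk_arcs t))"
    using assms(2) distinct_card[of "walk_arcs t"] by (simp add: euler_tour_def length_walk_arcs)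
  also have "\<dots> = card (\<Union>e\<in>F. {(u, v). {u, v} = e})"
    using assms(2) by (intro arg_cong[of _ _ card]) (auto simp: euler_tour_def)
  also have "\<dots> \<le> (\<Sum>e\<in>F. card {(u, v). {u, v} = e})"
    using fin by (rule card_UN_le)
  also have "\<dots> \<le> (\<Sum>e\<in>F. 2)"
  proof (rule sum_mono)
    fix e assume "e \<in> F"
    then obtain a b where "e = {a, b}"
      using assms(1) unfolding tree_def connected_graph_def graph_def by blast
    then have "{(u, v). {u, v} = e} \<subseteq> set [(a, b), (b, a)]" by (auto simp: doubleton_eq_iff)
    then have "card {(u, v). {u, v} = e} \<le> card (set [(a, b), (b, a)])"
      by (intro card_mono) auto
    also have "\<dots> \<le> 2" using card_length[of "[(a, b), (b, a)]"] by simp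
    finally show "card {(u, v). {u, v} = e} \<le> 2" .
  qed
  finally show ?thesis by (simp add: mult.commute)
qed

text \<open>The definition of the tour speaks of arcs, not of vertices. A vertex other than the
  start is the end of a tree edge, namely the last one on a walk from the start, and both arcs of
  that edge occur in the tour; this leaves the start, which covers the tree without edges.\<close>

lemma euler_tour_covers:
  assumes "tree T F" "euler_tour T F t"
  shows "T \<subseteq> set t"
proof
  fix v assume v: "v \<in> T"
  have t: "walk T F t" "set (walk_arcs t) = {(u, v). {u, v} \<in> F}"
    using assms(2) by (auto simp: euler_tour_def)
  then have "hd t \<in> T" by (auto simp: walk_def)
  then obtain p where p: "walk T F p" "hd p = hd t" "last p = v"
    using assms(1) v unfolding tree_def connected_graph_def by blast
  show "v \<in> set t"
  proof (cases "length p \<le> 1")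
    case True
    then have "v = hd t" using p by (cases p) (auto simp: walk_def)
    then show ?thesis using t by (simp add: walk_def)
  next
    case False
    then have "p ! Suc (length p - 2) = v"
      using p by (auto simp: last_conv_nth walk_def Suc_diff_Suc numeral_2_eq_2)
    then have "{v, p ! (length p - 2)} \<in> F"
      using walk_nth_edge[OF p(1), of "length p - 2"] False by (simp add: insert_commute)
    then have "(v, p ! (length p - 2)) \<in> set (walk_arcs t)" using t by simp
    then show ?thesis by (auto simp: walk_arcs_def dest: set_zip_leftD)
  qed
qed


section \<open>The phases of the algorithm\<close>

text \<open>Any terminal \<open>v\<close> can serve as reference point. It lies in the tree, so the
  approach is no longer than a shortest walk to \<open>v\<close>; the tour costs twice the tree; and
  since the tour passes \<open>v\<close>, its endpoint is within the tour length of
  \<open>v\<close>.\<close>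

lemma phase_walk_bound:
  assumes conn: "connected_graph V E" and q: "circular_coordinate V E \<rho> L q" and \<rho>: "0 \<le> \<rho>"
    and W: "W \<subseteq> V" and diam: "\<forall>x\<in>W. \<forall>y\<in>W. gdist V E x y \<le> D"
    and x: "x \<in> V" and v: "v \<in> W" and ph: "phase_walk V E W x p"
  shows "p \<noteq> []" "hd p = x" "last p \<in> V" "W \<subseteq> set p"
    and "real (length p - 1) \<le> gdist V E x v + 4 * \<rho> * D"
    and "gdist V E (last p) v \<le> 4 * \<rho> * D"
proof -
  have ne: "W \<noteq> {}" using v by blast
  obtain T F s t where T: "min_steiner_tree V E W T F" and s: "shortest_walk_to V E x T s"
    and t: "euler_tour T F t" "hd t = last s" and p: "p = s @ tl t"
    using ph ne by (auto simp: phase_walk_def)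
  have st: "T \<subseteq> V" "F \<subseteq> E" "tree T F" "W \<subseteq> T"
    using T by (auto simp: min_steiner_tree_def steiner_tree_def)
  obtain T' F' where "steiner_tree V E W T' F'" "real (card F') \<le> 2 * \<rho> * D"
    using steiner_tree_bound[OF conn q W ne \<rho> diam] by blast
  moreover from this(1) have "card F \<le> card F'" using T unfolding min_steiner_tree_def by blast
  ultimately have "real (card F) \<le> 2 * \<rho> * D" by linarith
  then have t_len: "real (length t - 1) \<le> 4 * \<rho> * D"
    using euler_tour_length[OF st(3) t(1)] by linarith
  have tw: "walk V E t" "hd t = last t"
    using t walk_mono[OF _ st(1,2)] by (auto simp: euler_tour_def)
  have sw: "walk V E s" "hd s = x" using s by (auto simp: shortest_walk_to_def)
  have ne': "s \<noteq> []" "t \<noteq> []" using tw sw by (auto simp: walk_def)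
  note app = walk_append[OF sw(1) tw(1) t(2)[symmetric]]
  show "p \<noteq> []" "hd p = x" using app sw p ne' by auto
  have lp: "last p = hd t" using app p tw by simp
  then show "last p \<in> V" using tw ne' by (auto simp: walk_def)
  have "set t \<subseteq> set p"
  proof
    fix y assume "y \<in> set t"
    then consider "y = last s" | "y \<in> set (tl t)" using t(2) by (cases t) auto
    then show "y \<in> set p" using ne' p by cases auto
  qed
  then show "W \<subseteq> set p" using euler_tour_covers[OF st(3) t(1)] st by blast
  have "v \<in> set t" using euler_tour_covers[OF st(3) t(1)] st v by blast
  then obtain i where i: "i < length t" "t ! i = v" by (auto simp: in_set_conv_nth)
  have "gdist V E (hd t) v \<le> real i"
    using gdist_le[OF walk_take(1)[OF tw(1) i(1)] refl refl] walk_take[OF tw(1) i(1)] i by simp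
  then show "gdist V E (last p) v \<le> 4 * \<rho> * D" using lp t_len i(1) by simp
  obtain s' where s': "walk V E s'" "hd s' = x" "last s' = v" "gdist V E x v = real (length s' - 1)"
    using shortest_walk[OF conn x, of v] v W by blast
  then have "length s \<le> length s'" using s st v unfolding shortest_walk_to_def by blast
  then have "real (length s - 1) \<le> gdist V E x v" using s' by simp
  moreover have "length p - 1 = (length s - 1) + (length t - 1)"
    using p ne' by (cases s; cases t) auto
  ultimately show "real (length p - 1) \<le> gdist V E x v + 4 * \<rho> * D" using t_len by linarith
qed

section \<open>Candidate sets\<close>

lemma candidates_Suc:
  "candidates V E f r (Suc n) = insert r {v \<in> V. phi0 V E f v \<le> 2 ^ n}"
proof (induction n)
  case (Suc n)
  have "{v \<in> V. phi0 V E f v \<le> 2 ^ n} \<subseteq> {v \<in> V. phi0 V E f v \<le> 2 ^ Suc n}"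
    unfolding power_Suc by auto
  then show ?case
    unfolding candidates.simps(2)[of V E f r "Suc n"] Suc by blast
qed simp

lemma candidates_Suc_minus_root:
  "candidates V E f r (Suc n) - {r} = {v \<in> V. phi0 V E f v \<le> 2 ^ n} - {r}"
  unfolding candidates_Suc by blast

lemma candidates_diameter:
  assumes "connected_graph V E" "u \<in> V" "v \<in> V" "phi0 V E f u \<le> 2 ^ n" "phi0 V E f v \<le> 2 ^ n"
  shows "gdist V E u v \<le> 2 * 2 ^ n"
proof -
  have "finite V" using assms(1) by (simp add: connected_graph_def graph_def)
  then have "card {x \<in> V. gdist V E x u \<noteq> gdist V E x v} \<le> 2 * 2 ^ n"
    using card_distinguishing_le_phi0[of V E u v f] assms(4,5) by linarith
  then have "real (card {x \<in> V. gdist V E x u \<noteq> gdist V E x v}) \<le> real (2 * 2 ^ n)"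
    unfolding of_nat_le_iff .
  then show ?thesis using gdist_le_card_distinguishing[OF assms(1-3)] by simp
qed

text \<open>If \<open>v\<close> and \<open>g\<close> differed, both would be distinguishing
  vertices, while the two error counts add up to at most 1. The general distance bound would only
  give distance at most 1.\<close>

lemma phi0_zero_unique:
  assumes conn: "connected_graph V E" and g: "g \<in> V" "phi0 V E f g = 0"
    and v: "v \<in> V" "phi0 V E f v \<le> 1"
  shows "v = g"
proof (rule ccontr)
  assume "v \<noteq> g"
  have fin: "finite V" using conn by (simp add: connected_graph_def graph_def)
  have "gdist V E v g \<ge> 1" "gdist V E g v \<ge> 1"
    using gdist_pos[OF conn] g v \<open>v \<noteq> g\<close> by auto
  then have "{v, g} \<subseteq> {x \<in> V. gdist V E x v \<noteq> gdist V E x g}"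
    using g v gdist_self[OF _ conn] by auto
  then have "card {v, g} \<le> card {x \<in> V. gdist V E x v \<noteq> gdist V E x g}"
    using fin by (intro card_mono) auto
  then show False
    using card_distinguishing_le_phi0[OF fin, of E v g f] g v \<open>v \<noteq> g\<close> by simp
qed

section \<open>Cost of a whole execution\<close>

lemma cost_until_le: "g \<in> set p \<Longrightarrow> cost_until g p \<le> length p - 1"
proof -
  assume "g \<in> set p"
  then have "length (takeWhile (\<lambda>v. v \<noteq> g) p) < length p" by (induction p) auto
  then show ?thesis by (simp add: cost_until_def)
qed

text \<open>Carries the bounds for one phase over to the accumulated walk. The diameter
  \<open>D\<close> is left free, because the case of error 0 needs \<open>D = 0\<close>.\<close>

lemma execution_phase:
  assumes conn: "connected_graph V E" and q: "circular_coordinate V E \<rho> L q" and \<rho>: "0 \<le> \<rho>"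
    and ex: "e0_planning_execution V E f r g P" and ng: "g \<notin> set (P n)"
    and W: "W = {v \<in> V. phi0 V E f v \<le> 2 ^ n} - {r}"
    and diam: "\<forall>x\<in>W. \<forall>y\<in>W. gdist V E x y \<le> D"
    and P: "P n \<noteq> []" "last (P n) \<in> V" and v: "v \<in> W"
  shows "P (Suc n) \<noteq> []" "last (P (Suc n)) \<in> V" "W \<subseteq> set (P (Suc n))"
    and "real (length (P (Suc n)) - 1) \<le> real (length (P n) - 1) + gdist V E (last (P n)) v + 4 * \<rho> * D"
    and "gdist V E (last (P (Suc n))) v \<le> 4 * \<rho> * D"
proof -
  obtain p where "phase_walk V E (candidates V E f r (Suc n) - {r}) (last (P n)) p"
    and PS: "P (Suc n) = P n @ tl p"
    using ex ng unfolding e0_planning_execution_def by metis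
  then have ph: "phase_walk V E W (last (P n)) p"
    using W by (simp only: candidates_Suc_minus_root)
  have WV: "W \<subseteq> V" using W by blast
  note b = phase_walk_bound[OF conn q \<rho> WV diam P(2) v ph]
  have last: "last (P (Suc n)) = last p" using PS b(1,2) P(1) by (cases p) auto
  then show "last (P (Suc n)) \<in> V" "gdist V E (last (P (Suc n))) v \<le> 4 * \<rho> * D" using b by auto
  show "P (Suc n) \<noteq> []" using PS P by simp
  have "set p \<subseteq> set (P (Suc n))" using PS b(1,2) P(1) by (cases p) auto
  then show "W \<subseteq> set (P (Suc n))" using b by blast
  have "length (P (Suc n)) - 1 = (length (P n) - 1) + (length p - 1)"
    using PS P b(1) by (cases "P n"; cases p) auto
  then show "real (length (P (Suc n)) - 1)
      \<le> real (length (P n) - 1) + gdist V E (last (P n)) v + 4 * \<rho> * D"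
    using b(5) by linarith
qed

lemma execution_cost:
  assumes conn: "connected_graph V E" and q: "circular_coordinate V E \<rho> L q" and \<rho>: "0 \<le> \<rho>"
    and r: "r \<in> V" and g: "g \<in> V" "g \<noteq> r" "phi0 V E f g \<le> 2 ^ N"
    and ex: "e0_planning_execution V E f r g P"
  shows "g \<in> set (P (Suc N))"
    and "real (length (P (Suc N)) - 1) \<le> gdist V E r g + (2 + 32 * \<rho>) * 2 ^ N"
proof -
  define W where "W n = {v \<in> V. phi0 V E f v \<le> 2 ^ n} - {r}" for n
  have W_mono: "W m \<subseteq> W n" if "m \<le> n" for m n
  proof
    fix v assume "v \<in> W m"
    moreover have "(2::nat) ^ m \<le> 2 ^ n" using that by (simp add: power_increasing)
    ultimately show "v \<in> W n" unfolding W_def using le_trans by blast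
  qed
  have diam: "\<forall>x\<in>W n. \<forall>y\<in>W n. gdist V E x y \<le> 2 * 2 ^ n" for n
    using candidates_diameter[OF conn, of _ _ f n] by (auto simp: W_def)
  have gW: "g \<in> W N" using g by (simp add: W_def)
  \<comment> \<open>Budget for the length walked so far plus the distance to some current terminal.
    The first departure from \<open>r\<close> is paid by OPT and the diameter
    \<open>2 * 2 ^ N\<close>. Phase \<open>n\<close> adds \<open>8 * \<rho> * 2 ^ n\<close> for its
    tour and at most as much for the distance from its endpoint back to the reference
    terminal.\<close>
  define B where "B n = gdist V E r g + 2 * 2 ^ N + 16 * \<rho> * 2 ^ n" for n
  have B_Suc: "B (Suc n) = B n + 16 * \<rho> * 2 ^ n" for n by (simp add: B_def)
  \<comment> \<open>\<open>P n = [r]\<close> covers the phases without terminals, before the searcher has left \<open>r\<close>.\<close>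
  define Inv where "Inv n \<longleftrightarrow> P n = [r] \<or>
    (P n \<noteq> [] \<and> last (P n) \<in> V \<and>
      (\<exists>v\<in>W n. real (length (P n) - 1) + gdist V E (last (P n)) v \<le> B n))" for n
  note step = execution_phase[OF conn q \<rho> ex _ W_def diam]
  \<comment> \<open>Once terminals exist, the budget inequality holds even if the searcher is still
    at \<open>r\<close>: these terminals also belong to phase \<open>N\<close>, so they lie within
    \<open>2 * 2 ^ N\<close> of the goal.\<close>
  have start: "P n \<noteq> [] \<and> last (P n) \<in> V \<and>
      (\<exists>v\<in>W n. real (length (P n) - 1) + gdist V E (last (P n)) v \<le> B n)"
    if nN: "n \<le> N" and I: "Inv n" and W_ne: "W n \<noteq> {}" for n
  proof (cases "P n = [r]")
    case True
    obtain v where v: "v \<in> W n" using W_ne by blast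
    then have "v \<in> W N" using W_mono[OF nN] by blast
    then have "gdist V E g v \<le> 2 * 2 ^ N" using diam gW by blast
    moreover have "gdist V E r v \<le> gdist V E r g + gdist V E g v"
      using gdist_triangle[OF conn r g(1), of v] v by (auto simp: W_def)
    moreover have "0 \<le> 16 * \<rho> * 2 ^ n" using \<rho> by simp
    ultimately have "gdist V E r v \<le> B n" unfolding B_def by linarith
    then show ?thesis using True v r by auto
  next
    case False
    then show ?thesis using I by (simp add: Inv_def)
  qed
  have Inv: "Inv n" if "n \<le> N" for n
    using that
  proof (induction n)
    case 0
    then show ?case using ex by (simp add: Inv_def e0_planning_execution_def)
  next
    case (Suc n)
    then have IH: "Inv n" by simp
    have BB: "B n \<le> B (Suc n)" using \<rho> by (simp add: B_Suc)
    show ?case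
    proof (cases "g \<in> set (P n)")
      case True
      then have "P (Suc n) = P n" using ex by (simp add: e0_planning_execution_def)
      then show ?thesis using IH W_mono[of n "Suc n"] BB unfolding Inv_def by force
    next
      case ng: False
      show ?thesis
      proof (cases "W n = {}")
        case True
        \<comment> \<open>The other alternative of the invariant provides a terminal, so without
          terminals the searcher has not left \<open>r\<close>, and it stays there.\<close>
        then have "P n = [r]" using IH by (auto simp: Inv_def)
        moreover obtain p where "phase_walk V E (candidates V E f r (Suc n) - {r}) (last (P n)) p"
          "P (Suc n) = P n @ tl p"
          using ex ng unfolding e0_planning_execution_def by metis
        ultimately have "P (Suc n) = [r]"
          using True unfolding candidates_Suc_minus_root W_def by (simp add: phase_walk_def)
        then show ?thesis by (simp add: Inv_def)
      next
        case False
        then obtain v where Pn: "P n \<noteq> []" "last (P n) \<in> V" and v: "v \<in> W n"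
          and le: "real (length (P n) - 1) + gdist V E (last (P n)) v \<le> B n"
          using start[OF _ IH] Suc by auto
        \<comment> \<open>The same \<open>v\<close> remains a terminal in the next phase, so it can
          be kept as reference point.\<close>
        have "real (length (P (Suc n)) - 1) + gdist V E (last (P (Suc n))) v \<le> B (Suc n)"
          using step(4,5)[OF ng Pn v] le B_Suc[of n] by fastforce
        then show ?thesis
          using step(1,2)[OF ng Pn v] W_mono[of n "Suc n"] v unfolding Inv_def by force
      qed
    qed
  qed
  have "W N \<noteq> {}" using gW by blast
  then obtain v where PN: "P N \<noteq> []" "last (P N) \<in> V" and v: "v \<in> W N"
    and le: "real (length (P N) - 1) + gdist V E (last (P N)) v \<le> B N"
    using start[OF order_refl Inv] by auto
  have "g \<in> set (P (Suc N)) \<and> real (length (P (Suc N)) - 1) \<le> B (Suc N)"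
  proof (cases "g \<in> set (P N)")
    case True
    then have "P (Suc N) = P N" using ex by (simp add: e0_planning_execution_def)
    moreover have "0 \<le> gdist V E (last (P N)) v"
      using gdist_nonneg[OF conn PN(2), of v] v by (simp add: W_def)
    moreover have "B N \<le> B (Suc N)" using \<rho> by (simp add: B_Suc)
    ultimately show ?thesis using True le by simp
  next
    case False
    have "real (length (P (Suc N)) - 1) \<le> B (Suc N)"
    proof -
      have "0 \<le> \<rho> * 2 ^ N" using \<rho> by simp
      then show ?thesis using step(4)[OF False PN v] le B_Suc[of N] by fastforce
    qed
    then show ?thesis using step(3)[OF False PN v] gW by blast
  qed
  then show "g \<in> set (P (Suc N))"
    and "real (length (P (Suc N)) - 1) \<le> gdist V E r g + (2 + 32 * \<rho>) * 2 ^ N"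
    by (auto simp: B_def algebra_simps)
qed

theorem theorem4:
  shows "\<exists>C::real. 0 < C \<and>
    (\<forall>(V :: nat set) E (f :: nat \<Rightarrow> real) r g \<rho> P.
       connected_graph V E \<longrightarrow> r \<in> V \<longrightarrow> g \<in> V \<longrightarrow> 0 \<le> \<rho> \<longrightarrow>
       embeds_in_weighted_path V E \<rho> \<or> embeds_in_weighted_cycle V E \<rho> \<longrightarrow>
       e0_planning_execution V E f r g P \<longrightarrow>
       (\<exists>n. g \<in> set (P n) \<and>
          real (cost_until g (P n)) \<le> gdist V E r g + C * \<rho> * real (err0 V E f g)))"
proof (intro exI[of _ "68::real"] conjI allI impI)
  fix V :: "nat set" and E and f :: "nat \<Rightarrow> real" and r g \<rho> P
  assume conn: "connected_graph V E" and r: "r \<in> V" and g: "g \<in> V" and \<rho>: "0 \<le> \<rho>"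
    and emb: "embeds_in_weighted_path V E \<rho> \<or> embeds_in_weighted_cycle V E \<rho>"
    and ex: "e0_planning_execution V E f r g P"
  obtain L q where q: "circular_coordinate V E \<rho> L q" using circular_coordinate_exists[OF emb] by blast
  have P0: "P 0 = [r]" using ex by (simp add: e0_planning_execution_def)
  have err: "err0 V E f g = phi0 V E f g" by (simp add: err0_def phi0_def)
  show "\<exists>n. g \<in> set (P n) \<and>
      real (cost_until g (P n)) \<le> gdist V E r g + 68 * \<rho> * real (err0 V E f g)"
  proof (cases "g = r")
    case True
    then show ?thesis
      using P0 gdist_self[OF r conn] \<rho> by (intro exI[of _ 0]) (simp add: cost_until_def)
  next
    case gr: False
    show ?thesis
    proof (cases "phi0 V E f g = 0")
      case True
      \<comment> \<open>Without error there is no additive term, so the first phase must go straight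
        to the goal: its only terminal is \<open>g\<close>, and diameter 0 makes the tour
        free.\<close>
      define W where "W = {v \<in> V. phi0 V E f v \<le> 2 ^ 0} - {r}"
      have W: "W = {g}"
      proof
        show "W \<subseteq> {g}" using phi0_zero_unique[OF conn g True] unfolding W_def power_0 by blast
        show "{g} \<subseteq> W" using g gr True by (simp add: W_def)
      qed
      have diam: "\<forall>x\<in>W. \<forall>y\<in>W. gdist V E x y \<le> 0"
        using W gdist_self[OF g conn] by simp
      have "g \<notin> set (P 0)" "P 0 \<noteq> []" "last (P 0) \<in> V" "g \<in> W"
        using P0 gr r W by auto
      note step = execution_phase(3,4)[OF conn q \<rho> ex this(1) W_def diam this(2-4)]
      have "g \<in> set (P (Suc 0))" using step(1) W by blast
      moreover have "real (length (P (Suc 0)) - 1) \<le> gdist V E r g"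
        using step(2) unfolding P0 by simp
      ultimately
      show ?thesis
        using cost_until_le[of g "P (Suc 0)"] True err by (intro exI[of _ "Suc 0"]) auto
    next
      case False
      define N where "N = (LEAST n. phi0 V E f g \<le> 2 ^ n)"
      have N: "phi0 V E f g \<le> 2 ^ N"
        unfolding N_def by (rule LeastI[of _ "phi0 V E f g"]) (simp add: less_imp_le)
      \<comment> \<open>By minimality of \<open>N\<close> the threshold overshoots the error by less
        than a factor 2; for \<open>N = 0\<close> the bound uses that the error is positive.\<close>
      have "(2::nat) ^ N \<le> 2 * phi0 V E f g"
      proof (cases N)
        case (Suc k)
        then have "\<not> phi0 V E f g \<le> 2 ^ k"
          using not_less_Least[of k "\<lambda>n. phi0 V E f g \<le> 2 ^ n"] N_def by simp
        then show ?thesis using Suc by simp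
      qed (use False in simp)
      then have "real (2 ^ N) \<le> real (2 * phi0 V E f g)" unfolding of_nat_le_iff .
      then have N2: "(2::real) ^ N \<le> 2 * real (phi0 V E f g)" by simp
      \<comment> \<open>A noncontracting map cannot have upper factor below 1 on two vertices at
        positive distance, here \<open>r\<close> and \<open>g\<close>.\<close>
      have "1 \<le> \<rho>"
      proof -
        have "1 \<le> gdist V E r g" using gdist_pos[OF conn r g] gr by auto
        moreover have "gdist V E r g \<le> \<rho> * gdist V E r g"
          using q r g unfolding circular_coordinate_def by (meson order_trans)
        ultimately show ?thesis
          using mult_strict_right_mono[of \<rho> 1 "gdist V E r g"] by linarith
      qed
      \<comment> \<open>Source of the constant: \<open>2 + 32 * \<rho> \<le> 34 * \<rho>\<close>,
        and the factor 2 lost in the choice of \<open>N\<close> gives 68.\<close>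
      then have "(2 + 32 * \<rho>) * 2 ^ N \<le> (34 * \<rho>) * (2 * real (phi0 V E f g))"
        using N2 by (intro mult_mono) auto
      then have "real (length (P (Suc N)) - 1) \<le> gdist V E r g + 68 * \<rho> * real (err0 V E f g)"
        using execution_cost(2)[OF conn q \<rho> r g gr N ex] err by simp
      moreover have "g \<in> set (P (Suc N))" using execution_cost(1)[OF conn q \<rho> r g gr N ex] .
      ultimately show ?thesis
        using cost_until_le[of g "P (Suc N)"] by (intro exI[of _ "Suc N"]) auto
    qed
  qed
qed simp

end
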